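(* If $A\in\mathcal{KT}(\Delta^0_2)$, then $A$ has a countable lower $\leq_K$-cone; that is, the set $\{B\in 2^{\omega}: B\leq_K A\}$ is countable.
   Context: Reals are elements of $2^{\omega}$ (infinite binary sequences); $A\upharpoonright n$ is the initial segment of $A$ of length $n$. $K(\sigma)$ is the prefix-free Kolmogorov complexity of the finite binary string $\sigma$ with respect to a fixed universal prefix-free machine, and for $n \in \omega$, $K(n)$ denotes the complexity of the string of $n$ zeros. An order is a function $g:\omega\to\omega$ that is nondecreasing and unbounded (not necessarily recursive). For $g:\omega\to\omega$, $\mathcal{KT}(g)$ is the set of reals $A$ for which there is a constant $c$ such that for all $n\in\omega$, $K(A\upharpoonright n)\leq K(n)+g(n)+c$. $\mathcal{KT}(\Delta^0_2)$ is the intersection of $\mathcal{KT}(g)$ over all $\Delta^0_2$ orders $g$. For reals $A,B$, $B\leq_K A$ means that there is a constant $c$ such that for all $n$, $K(B\upharpoonright n)\leq K(A\upharpoonright n)+c$. *)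

theory Defs
  imports Main "HOL-Library.Sublist" "HOL-Library.Countable_Set"
begin

section \<open>Partial recursive functions\<close>

text \<open>Descriptions of mu-recursive functions and their (call-by-value) graph semantics.
  Arities are those of the argument lists; a description applied to a list on which no rule
  applies (e.g. of the wrong length) is simply undefined there.\<close>

datatype recf =
    Zero
  | Succ
  | Proj nat
  | Comp recf "recf list"
  | Prim recf recf
  | Mu recf

inductive evals :: "recf \<Rightarrow> nat list \<Rightarrow> nat \<Rightarrow> bool" where
  zero: "evals Zero xs 0"
| succ: "evals Succ [x] (Suc x)"
| proj: "i < length xs \<Longrightarrow> evals (Proj i) xs (xs ! i)"
| comp: "list_all2 (\<lambda>g v. evals g xs v) gs vs \<Longrightarrow> evals f vs y \<Longrightarrow> evals (Comp f gs) xs y"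
| prim_0: "evals f xs y \<Longrightarrow> evals (Prim f g) (0 # xs) y"
| prim_Suc: "evals (Prim f g) (n # xs) r \<Longrightarrow> evals g (n # r # xs) y
    \<Longrightarrow> evals (Prim f g) (Suc n # xs) y"
| mu: "evals f (n # xs) 0 \<Longrightarrow> (\<And>m. m < n \<Longrightarrow> \<exists>v. evals f (m # xs) (Suc v))
    \<Longrightarrow> evals (Mu f) xs n"

inductive_cases evals_ZeroE: "evals Zero xs y"
inductive_cases evals_SuccE: "evals Succ xs y"
inductive_cases evals_ProjE: "evals (Proj i) xs y"
inductive_cases evals_CompE: "evals (Comp f gs) xs y"
inductive_cases evals_Prim_0E: "evals (Prim f g) (0 # xs) y"
inductive_cases evals_Prim_SucE: "evals (Prim f g) (Suc n # xs) y"
inductive_cases evals_MuE: "evals (Mu f) xs y"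

lemma evals_deterministic:
  assumes "evals f xs y" and "evals f xs z"
  shows "y = z"
  using assms
proof (induction arbitrary: z rule: evals.induct)
  case (zero xs)
  then show ?case by (rule evals_ZeroE) simp
next
  case (succ x)
  then show ?case by (rule evals_SuccE) simp
next
  case (proj i xs)
  from proj(2) show ?case by (rule evals_ProjE) simp
next
  case (comp xs gs vs f y)
  from comp.prems obtain ws where ws: "list_all2 (\<lambda>g v. evals g xs v) gs ws" "evals f ws z"
    by (rule evals_CompE)
  have "vs = ws"
    using comp.IH(1) ws(1)
    by (auto simp: list_all2_conv_all_nth intro!: nth_equalityI)
  with ws(2) show ?case by (intro comp.IH(2)) simp
next
  case (prim_0 f xs y g)
  from prim_0.prems show ?case by (rule evals_Prim_0E) (rule prim_0.IH)
next
  case (prim_Suc f g n xs r y)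
  from prim_Suc.prems obtain s where s: "evals (Prim f g) (n # xs) s" "evals g (n # s # xs) z"
    by (rule evals_Prim_SucE)
  from prim_Suc.IH(1)[OF s(1)] s(2) show ?case by (intro prim_Suc.IH(2)) simp
next
  case (mu f n xs)
  from mu.prems have z: "evals f (z # xs) 0" "\<And>m. m < z \<Longrightarrow> \<exists>v. evals f (m # xs) (Suc v)"
    by (auto elim: evals_MuE)
  show ?case
  proof (cases n z rule: linorder_cases)
    case less
    with z(2) obtain v where "evals f (n # xs) (Suc v)" by blast
    then have "0 = Suc v" by (rule mu.IH(1))
    then show ?thesis by simp
  next
    case greater
    with mu.IH(2) z(1) have "\<exists>v. Suc v = 0" by blast
    then show ?thesis by simp
  qed
qed

definition recursive_rel :: "nat \<Rightarrow> (nat list \<Rightarrow> bool) \<Rightarrow> bool" where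
  "recursive_rel k R \<longleftrightarrow>
    (\<exists>f. \<forall>xs. length xs = k \<longrightarrow> evals f xs (if R xs then 1 else 0))"


section \<open>The second level of the arithmetical hierarchy\<close>

definition Sigma02 :: "nat \<Rightarrow> (nat list \<Rightarrow> bool) \<Rightarrow> bool" where
  "Sigma02 k S \<longleftrightarrow> (\<exists>R. recursive_rel (k + 2) R \<and>
    (\<forall>xs. length xs = k \<longrightarrow> (S xs \<longleftrightarrow> (\<exists>a. \<forall>b. R (a # b # xs)))))"

definition Pi02 :: "nat \<Rightarrow> (nat list \<Rightarrow> bool) \<Rightarrow> bool" where
  "Pi02 k S \<longleftrightarrow> (\<exists>R. recursive_rel (k + 2) R \<and>
    (\<forall>xs. length xs = k \<longrightarrow> (S xs \<longleftrightarrow> (\<forall>a. \<exists>b. R (a # b # xs)))))"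

definition Delta02 :: "nat \<Rightarrow> (nat list \<Rightarrow> bool) \<Rightarrow> bool" where
  "Delta02 k S \<longleftrightarrow> Sigma02 k S \<and> Pi02 k S"

text \<open>A function is $\Delta^0_2$ if its graph is.\<close>

definition Delta02_fun :: "(nat \<Rightarrow> nat) \<Rightarrow> bool" where
  "Delta02_fun g \<longleftrightarrow> Delta02 2 (\<lambda>xs. g (xs ! 0) = xs ! 1)"


section \<open>Prefix-free machines and Kolmogorov complexity\<close>

text \<open>Strings are coded by bijective base-2 numerals, least significant digit first.\<close>

fun code :: "bool list \<Rightarrow> nat" where
  "code [] = 0"
| "code (b # bs) = 2 * code bs + (if b then 2 else 1)"

lemma bij_code: "bij code"
proof (rule bijI)
  have "code xs = code ys \<Longrightarrow> xs = ys" for xs ys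
  proof (induction xs arbitrary: ys)
    case Nil
    then show ?case by (cases ys) (auto split: if_splits)
  next
    case (Cons a xs)
    show ?case
    proof (cases ys)
      case Nil
      then show ?thesis using Cons.prems by (auto split: if_splits)
    next
      case (Cons b zs)
      have eq: "2 * code xs + (if a then 2 else 1) = 2 * code zs + (if b then 2 else 1)"
        using Cons.prems \<open>ys = b # zs\<close> by simp
      have "a = b" using eq by (cases a; cases b; simp; presburger)
      then have "code xs = code zs" using eq by simp
      then show ?thesis using Cons.IH \<open>a = b\<close> \<open>ys = b # zs\<close> by simp
    qed
  qed
  then show "inj code" by (rule injI)
next
  have "\<exists>xs. code xs = n" for n
  proof (induction n rule: less_induct)
    case (less n)
    show ?case
    proof (cases "n = 0")
      case True
      then show ?thesis by (metis code.simps(1))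
    next
      case False
      then obtain xs where "code xs = (n - 1) div 2" using less by fastforce
      then have "code (even n # xs) = n" using False by simp presburger
      then show ?thesis by blast
    qed
  qed
  then show "surj code" unfolding surj_def by metis
qed

definition partial_recursive :: "(bool list \<rightharpoonup> bool list) \<Rightarrow> bool" where
  "partial_recursive M \<longleftrightarrow>
    (\<exists>f. \<forall>\<sigma> y. evals f [code \<sigma>] y \<longleftrightarrow> map_option code (M \<sigma>) = Some y)"

definition prefix_free_machine :: "(bool list \<rightharpoonup> bool list) \<Rightarrow> bool" where
  "prefix_free_machine M \<longleftrightarrow> partial_recursive M \<and>
    (\<forall>\<sigma>\<in>dom M. \<forall>\<tau>\<in>dom M. \<not> strict_prefix \<sigma> \<tau>)"

text \<open>Every prefix-free machine is simulated by means of a coding string; the equation is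
  between partial values.\<close>

definition universal_prefix_free_machine :: "(bool list \<rightharpoonup> bool list) \<Rightarrow> bool" where
  "universal_prefix_free_machine U \<longleftrightarrow> prefix_free_machine U \<and>
    (\<forall>M. prefix_free_machine M \<longrightarrow> (\<exists>\<rho>. \<forall>\<sigma>. U (\<rho> @ \<sigma>) = M \<sigma>))"

text \<open>The minimum is over a nonempty set whenever \<open>U\<close> is universal.\<close>

definition K :: "(bool list \<rightharpoonup> bool list) \<Rightarrow> bool list \<Rightarrow> nat" where
  "K U \<tau> = (LEAST n. \<exists>\<sigma>. length \<sigma> = n \<and> U \<sigma> = Some \<tau>)"

definition K_nat :: "(bool list \<rightharpoonup> bool list) \<Rightarrow> nat \<Rightarrow> nat" where
  "K_nat U n = K U (replicate n False)"


section \<open>Reals, orders and the reducibility\<close>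

type_synonym cantor = "nat \<Rightarrow> bool"

definition restrict :: "cantor \<Rightarrow> nat \<Rightarrow> bool list" (infix "\<restriction>" 90) where
  "A \<restriction> n = map A [0..<n]"

definition is_order :: "(nat \<Rightarrow> nat) \<Rightarrow> bool" where
  "is_order g \<longleftrightarrow> mono g \<and> \<not> bdd_above (range g)"

definition KT :: "(bool list \<rightharpoonup> bool list) \<Rightarrow> (nat \<Rightarrow> nat) \<Rightarrow> cantor set" where
  "KT U g = {A. \<exists>c. \<forall>n. K U (A \<restriction> n) \<le> K_nat U n + g n + c}"

definition KT_Delta02 :: "(bool list \<rightharpoonup> bool list) \<Rightarrow> cantor set" where
  "KT_Delta02 U = (\<Inter>g\<in>{g. is_order g \<and> Delta02_fun g}. KT U g)"

definition le_K :: "(bool list \<rightharpoonup> bool list) \<Rightarrow> cantor \<Rightarrow> cantor \<Rightarrow> bool" where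
  "le_K U B A \<longleftrightarrow> (\<exists>c. \<forall>n. K U (B \<restriction> n) \<le> K U (A \<restriction> n) + c)"

end

(* Every A with K(A|n) <= K(n) + lg lg lg n + O(1) already has a countable lower cone. For n' of
very low complexity, a shortest program p of A|n' is much shorter than lg lg n', so every number
pair p q with q not much longer than p is below n', and A up to pair p q is computable from p
and q. Let q be a program whose output has length pair p b for some b. Then p can be read off
that length, so A|(pair p q) has complexity at most |q| + O(1). If N reals B were below A with
the same constant, each such q would give rise to N programs, of total weight at least
N 2^-O(1) 2^-|q|, for the strings B|(pair p q), and these are again programs of the same kind.
Because distinct q give distinct lengths pair p q, for N large the weight of such a set of
programs doubles in each round, and after |p| + O(1) rounds it exceeds 1, against Kraft's
inequality. So each constant admits only finitely many B. *)

theory Submission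
  imports Defs Complex_Main "HOL-Library.Discrete_Functions"
begin

section \<open>Closure properties of total recursive functions, and recursive graphs\<close>

section \<open>Total recursive functions\<close>

text \<open>Speaking of values instead of descriptions lets recursiveness of an explicit term be
  proved by closure rules that follow its syntax.\<close>

definition rec_fun :: "nat \<Rightarrow> (nat list \<Rightarrow> nat) \<Rightarrow> bool" where
  "rec_fun k F \<longleftrightarrow> (\<exists>f. \<forall>xs. length xs = k \<longrightarrow> evals f xs (F xs))"

lemma rec_fun_cong:
  assumes "rec_fun k F" and "\<And>xs. length xs = k \<Longrightarrow> F xs = G xs"
  shows "rec_fun k G"
  using assms unfolding rec_fun_def by fastforce

lemma rec_fun_nth: "i < k \<Longrightarrow> rec_fun k (\<lambda>xs. xs ! i)"
  unfolding rec_fun_def by (auto intro!: exI[of _ "Proj i"] evals.proj)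

lemma rec_fun_comp:
  assumes F: "rec_fun (length Gs) F" and Gs: "\<And>G. G \<in> set Gs \<Longrightarrow> rec_fun k G"
  shows "rec_fun k (\<lambda>xs. F (map (\<lambda>G. G xs) Gs))"
proof -
  obtain f where f: "\<And>xs. length xs = length Gs \<Longrightarrow> evals f xs (F xs)"
    using F unfolding rec_fun_def by blast
  obtain g where g: "\<And>G xs. G \<in> set Gs \<Longrightarrow> length xs = k \<Longrightarrow> evals (g G) xs (G xs)"
    using Gs unfolding rec_fun_def by metis
  have "evals (Comp f (map g Gs)) xs (F (map (\<lambda>G. G xs) Gs))" if "length xs = k" for xs
    by (rule evals.comp[where vs = "map (\<lambda>G. G xs) Gs"])
      (use f g that in \<open>auto simp: list_all2_conv_all_nth\<close>)
  then show ?thesis unfolding rec_fun_def by blast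
qed

lemma rec_fun_comp1:
  assumes "rec_fun 1 (\<lambda>xs. F (xs ! 0))" and "rec_fun k G"
  shows "rec_fun k (\<lambda>xs. F (G xs))"
  using rec_fun_comp[of "[G]" "\<lambda>xs. F (xs ! 0)" k] assms by auto

lemma rec_fun_comp2:
  assumes "rec_fun 2 (\<lambda>xs. F (xs ! 0) (xs ! 1))" and "rec_fun k G" and "rec_fun k H"
  shows "rec_fun k (\<lambda>xs. F (G xs) (H xs))"
  using rec_fun_comp[of "[G, H]" "\<lambda>xs. F (xs ! 0) (xs ! 1)" k] assms
  by (auto simp: numeral_2_eq_2)

lemma rec_fun_comp3:
  assumes "rec_fun 3 (\<lambda>xs. F (xs ! 0) (xs ! 1) (xs ! 2))"
    and "rec_fun k G" and "rec_fun k H" and "rec_fun k I"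
  shows "rec_fun k (\<lambda>xs. F (G xs) (H xs) (I xs))"
  using rec_fun_comp[of "[G, H, I]" "\<lambda>xs. F (xs ! 0) (xs ! 1) (xs ! 2)" k] assms
  by (auto simp: numeral_3_eq_3 numeral_2_eq_2)

text \<open>\<open>P\<close> is given in closed form, so only its recursion equations need checking.
  In \<open>G\<close>, index 0 is the counter, index 1 the previous value, and the parameters start
  at 2.\<close>

lemma rec_fun_prim:
  assumes F: "rec_fun k F" and G: "rec_fun (Suc (Suc k)) G"
    and P0: "\<And>xs. length xs = k \<Longrightarrow> P (0 # xs) = F xs"
    and PS: "\<And>n xs. length xs = k \<Longrightarrow> P (Suc n # xs) = G (n # P (n # xs) # xs)"
  shows "rec_fun (Suc k) P"
proof -
  obtain f where f: "\<And>xs. length xs = k \<Longrightarrow> evals f xs (F xs)"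
    using F unfolding rec_fun_def by blast
  obtain g where g: "\<And>xs. length xs = Suc (Suc k) \<Longrightarrow> evals g xs (G xs)"
    using G unfolding rec_fun_def by blast
  have "evals (Prim f g) (n # xs) (P (n # xs))" if "length xs = k" for n xs
  proof (induction n)
    case 0
    show ?case using f[OF that] by (simp add: P0[OF that] evals.prim_0)
  next
    case (Suc n)
    then show ?case using g[of "n # P (n # xs) # xs"] that
      by (simp add: PS[OF that] evals.prim_Suc)
  qed
  then show ?thesis unfolding rec_fun_def by (metis length_Suc_conv)
qed

lemma rec_fun_Least:
  assumes F: "rec_fun (Suc k) F" and ex: "\<And>xs. length xs = k \<Longrightarrow> \<exists>n. F (n # xs) = 0"
  shows "rec_fun k (\<lambda>xs. LEAST n. F (n # xs) = 0)"
proof -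
  obtain f where f: "\<And>xs. length xs = Suc k \<Longrightarrow> evals f xs (F xs)"
    using F unfolding rec_fun_def by blast
  have "evals (Mu f) xs (LEAST n. F (n # xs) = 0)" if xs: "length xs = k" for xs
  proof (rule evals.mu)
    show "evals f ((LEAST n. F (n # xs) = 0) # xs) 0"
      using f[of "(LEAST n. F (n # xs) = 0) # xs"] LeastI_ex[OF ex[OF xs]] xs by simp
    show "\<exists>v. evals f (m # xs) (Suc v)" if "m < (LEAST n. F (n # xs) = 0)" for m
      using not_less_Least[OF that] f[of "m # xs"] xs by (metis length_Cons not0_implies_Suc)
  qed
  then show ?thesis unfolding rec_fun_def by blast
qed

lemma rec_fun_Suc:
  assumes "rec_fun k F"
  shows "rec_fun k (\<lambda>xs. Suc (F xs))"
proof (rule rec_fun_comp1[OF _ assms])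
  have "evals Succ xs (Suc (xs ! 0))" if "length xs = 1" for xs
    using that by (auto simp: length_Suc_conv intro: evals.succ)
  then show "rec_fun 1 (\<lambda>xs. Suc (xs ! 0))" unfolding rec_fun_def by blast
qed

lemma rec_fun_const: "rec_fun k (\<lambda>_. c)"
proof (induction c)
  case 0
  show ?case unfolding rec_fun_def by (blast intro: evals.zero)
next
  case (Suc c)
  then show ?case by (rule rec_fun_Suc)
qed

lemma rec_fun_add:
  assumes "rec_fun k F" and "rec_fun k G"
  shows "rec_fun k (\<lambda>xs. F xs + G xs)"
proof (rule rec_fun_comp2[OF _ assms])
  have "rec_fun (Suc 1) (\<lambda>xs. xs ! 0 + xs ! 1)"
    by (rule rec_fun_prim[where F = "\<lambda>xs. xs ! 0" and G = "\<lambda>xs. Suc (xs ! 1)"])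
      (auto intro: rec_fun_nth rec_fun_Suc)
  then show "rec_fun 2 (\<lambda>xs. xs ! 0 + xs ! 1)" by (simp add: numeral_2_eq_2)
qed

lemma rec_fun_diff:
  assumes "rec_fun k F" and "rec_fun k G"
  shows "rec_fun k (\<lambda>xs. F xs - G xs)"
\<comment> \<open>\<open>Prim\<close> recurses on its first argument, truncated subtraction on the
  subtrahend; hence the swap.\<close>
proof (rule rec_fun_comp2[where F = "\<lambda>a b. b - a", OF _ assms(2,1)])
  have "rec_fun (Suc 0) (\<lambda>xs. xs ! 0 - 1)"
    by (rule rec_fun_prim[where F = "\<lambda>_. 0" and G = "\<lambda>xs. xs ! 0"])
      (auto intro: rec_fun_nth rec_fun_const)
  then have pred: "rec_fun 1 (\<lambda>xs. xs ! 0 - 1)" by simp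
  have "rec_fun (Suc 1) (\<lambda>xs. xs ! 1 - xs ! 0)"
    by (rule rec_fun_prim[where F = "\<lambda>xs. xs ! 0" and G = "\<lambda>xs. xs ! 1 - 1"])
      (auto intro!: rec_fun_nth rec_fun_comp1[OF pred, unfolded One_nat_def])
  then show "rec_fun 2 (\<lambda>xs. xs ! 1 - xs ! 0)" by (simp add: numeral_2_eq_2)
qed

lemma rec_fun_If0:
  assumes "rec_fun k C" and "rec_fun k F" and "rec_fun k G"
  shows "rec_fun k (\<lambda>xs. if C xs = 0 then F xs else G xs)"
proof (rule rec_fun_comp3[where F = "\<lambda>c a b. if c = 0 then a else b", OF _ assms])
  \<comment> \<open>A case distinction is a recursion whose successor step ignores the previous
    value. Index 3 holds the second branch, behind counter, previous value and first branch.\<close>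
  have "rec_fun (Suc 2) (\<lambda>xs. if xs ! 0 = 0 then xs ! 1 else xs ! 2)"
    by (rule rec_fun_prim[where F = "\<lambda>xs. xs ! 0" and G = "\<lambda>xs. xs ! 3"])
      (auto intro: rec_fun_nth simp: numeral_2_eq_2 numeral_3_eq_3)
  then show "rec_fun 3 (\<lambda>xs. if xs ! 0 = 0 then xs ! 1 else xs ! 2)"
    by (simp add: numeral_3_eq_3 numeral_2_eq_2)
qed

lemma rec_fun_mod:
  assumes "rec_fun k F" and "rec_fun k G"
  shows "rec_fun k (\<lambda>xs. F xs mod G xs)"
proof (rule rec_fun_comp2[OF _ assms])
  have "rec_fun (Suc 1) (\<lambda>xs. xs ! 0 mod xs ! 1)"
  \<comment> \<open>The remainder counts up and resets on reaching the modulus, which the sum of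
    both truncated differences detects. For modulus 0 it never resets, in accord with
    \<open>x mod 0 = x\<close>.\<close>
  proof (rule rec_fun_prim[where F = "\<lambda>_. 0" and
        G = "\<lambda>xs. if (Suc (xs ! 1) - xs ! 2) + (xs ! 2 - Suc (xs ! 1)) = 0
                   then 0 else Suc (xs ! 1)"])
    show "rec_fun (Suc (Suc 1)) (\<lambda>xs. if (Suc (xs ! 1) - xs ! 2) + (xs ! 2 - Suc (xs ! 1)) = 0
                   then 0 else Suc (xs ! 1))"
      by (intro rec_fun_If0 rec_fun_add rec_fun_diff rec_fun_Suc rec_fun_nth rec_fun_const) auto
  qed (auto simp: mod_Suc rec_fun_const)
  then show "rec_fun 2 (\<lambda>xs. xs ! 0 mod xs ! 1)" by (simp add: numeral_2_eq_2)
qed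

lemma recursive_rel_eq:
  assumes "rec_fun k F" and "rec_fun k G"
  shows "recursive_rel k (\<lambda>xs. F xs = G xs)"
proof -
  have "rec_fun k (\<lambda>xs. if (F xs - G xs) + (G xs - F xs) = 0 then 1 else 0)"
    by (intro rec_fun_If0 rec_fun_add rec_fun_diff rec_fun_const assms)
  then have "rec_fun k (\<lambda>xs. if F xs = G xs then 1 else 0)"
    by (rule rec_fun_cong) auto
  then show ?thesis unfolding rec_fun_def recursive_rel_def .
qed

text \<open>Both quantifiers can be dummies over a recursive graph, so one relation serves both
  forms; the arguments of the graph then sit at positions 2 and 3.\<close>

lemma Delta02_fun_if_rec_fun:
  assumes "rec_fun 1 (\<lambda>xs. g (xs ! 0))"
  shows "Delta02_fun g"
proof -
  have "recursive_rel (2 + 2) (\<lambda>xs. g (xs ! 2) = xs ! 3)"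
    by (intro recursive_rel_eq rec_fun_comp1[OF assms] rec_fun_nth) auto
  then show ?thesis
    unfolding Delta02_fun_def Delta02_def Sigma02_def Pi02_def
    by (intro conjI exI[of _ "\<lambda>xs. g (xs ! 2) = xs ! 3"]) auto
qed


section \<open>Recursive arithmetic on codes: length, pairing and truncation\<close>

section \<open>Arithmetic of string codes\<close>

text \<open>This is the code of the string of \<open>n\<close> zeros, the least code of a string of
  length \<open>n\<close>.\<close>

definition expo :: "nat \<Rightarrow> nat" where "expo n = 2 ^ n - 1"

text \<open>The \<open>Suc\<close> makes this the length of the string with code
  \<open>n\<close>.\<close>

definition lg :: "nat \<Rightarrow> nat" where "lg n = floor_log (Suc n)"

text \<open>Since \<open>a < 2 ^ (a + b)\<close>, \<open>lg\<close> recovers \<open>a + b\<close>,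
  and \<open>a\<close> is the remaining offset. Only the first component is ever decoded; in the
  second one, injectivity is enough.\<close>

definition pair :: "nat \<Rightarrow> nat \<Rightarrow> nat" where "pair a b = expo (a + b) + a"

definition pair_fst :: "nat \<Rightarrow> nat" where "pair_fst n = n - expo (lg n)"

lemma Suc_expo: "Suc (expo n) = 2 ^ n"
  by (simp add: expo_def)

lemma expo_ge: "n \<le> expo n"
  using less_exp[of n] unfolding expo_def by linarith

lemma expo_mono: "m \<le> n \<Longrightarrow> expo m \<le> expo n"
  unfolding expo_def by (intro diff_le_mono power_increasing) auto

lemma expo_Suc: "expo (Suc n) = Suc (2 * expo n)"
proof -
  have "(1::nat) \<le> 2 ^ n" by simp
  then show ?thesis unfolding expo_def power_Suc by linarith
qed

lemma lg_eqI: "2 ^ k \<le> Suc n \<Longrightarrow> Suc n < 2 ^ Suc k \<Longrightarrow> lg n = k"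
  unfolding lg_def by (rule floor_log_eqI) simp_all

lemma expo_lg_le: "expo (lg n) \<le> n"
  using floor_log_exp2_le[of "Suc n"] by (simp add: expo_def lg_def)

lemma less_expo_lg: "n < expo (Suc (lg n))"
  using floor_log_exp2_gt[of "Suc n"] by (simp add: expo_def lg_def)

lemma lg_expo [simp]: "lg (expo n) = n"
  by (rule lg_eqI) (simp_all add: Suc_expo)

lemma mono_lg: "mono lg"
  unfolding lg_def by (intro monoI floor_log_le_iff) simp

lemma pair_fst_pair [simp]: "pair_fst (pair a b) = a"
proof -
  have "a < 2 ^ (a + b)"
    using less_exp[of a] by (rule less_le_trans) (simp add: power_increasing)
  then have "lg (pair a b) = a + b"
    by (intro lg_eqI) (auto simp: pair_def simp flip: Suc_expo)
  then show ?thesis by (simp add: pair_fst_def) (simp add: pair_def)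
qed

lemma pair_ge_fst: "a \<le> pair a b"
  by (simp add: pair_def)

lemma expo_less_mono: "m < n \<Longrightarrow> expo m < expo n"
  by (metis Suc_expo Suc_less_eq one_less_numeral_iff power_strict_increasing semiring_norm(76))

lemma inj_pair: "inj (pair a)"
proof (rule strict_mono_imp_inj_on)
  show "strict_mono (pair a)"
    by (rule strict_monoI) (simp add: pair_def expo_less_mono)
qed

text \<open>One increment of \<open>m\<close> absorbs the sum \<open>a + b\<close>, the other the
  trailing \<open>a\<close>. The double exponential is the shape of the length \<open>n\<close> in
  \<open>finite_lower_cone\<close>.\<close>

lemma pair_le:
  assumes "a \<le> expo m" and "b \<le> expo m"
  shows "pair a b \<le> expo (expo (Suc (Suc m)))"
proof -
  have ab: "a + b \<le> expo (Suc m)" using assms by (simp add: expo_Suc)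
  have "pair a b \<le> expo (a + b) + expo (a + b)"
    using expo_ge[of "a + b"] unfolding pair_def by linarith
  also have "\<dots> \<le> expo (Suc (a + b))" by (simp add: expo_Suc)
  also have "\<dots> \<le> expo (expo (Suc (Suc m)))"
    using ab by (intro expo_mono) (simp add: expo_Suc)
  finally show ?thesis .
qed

lemma mult_lg_le: "\<exists>m. \<forall>n\<ge>m. c * (lg n + 1) \<le> n"
proof -
  have square: "(k + 1) * (k + 1) \<le> 4 * 2 ^ k" for k :: nat
  proof (induction k)
    case (Suc k)
    have "2 * k + 3 \<le> 4 * 2 ^ k"
      using less_exp[of k] by linarith
    with Suc show ?case by (simp add: algebra_simps)
  qed simp
  \<comment> \<open>The 8 in the threshold pays for the factor 4 in \<open>square\<close> and leaves
    a factor 2, which bridges the gap between \<open>2 ^ lg n \<le> Suc n\<close> and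
    \<open>n\<close>.\<close>
  have "c * (lg n + 1) \<le> n" if n: "n \<ge> expo (8 * c + 1)" for n
  proof -
    have lg: "8 * c + 1 \<le> lg n" using monoD[OF mono_lg n] by simp
    then have "(8 * c) * (lg n + 1) \<le> (lg n + 1) * (lg n + 1)"
      by (intro mult_le_mono1) simp
    also have "\<dots> \<le> 4 * 2 ^ lg n" by (rule square)
    finally have "2 * (c * (lg n + 1)) \<le> 2 ^ lg n" by simp
    then show ?thesis using expo_lg_le[of n] less_exp[of "lg n"] lg
      by (simp flip: Suc_expo)
  qed
  then show ?thesis by blast
qed

lemma code_bounds: "2 ^ length z \<le> Suc (code z)" "Suc (code z) < 2 ^ Suc (length z)"
  by (induction z) auto

lemma lg_code [simp]: "lg (code z) = length z"
  using code_bounds by (rule lg_eqI)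

lemma code_le: "length z \<le> n \<Longrightarrow> code z \<le> expo (Suc n)"
  using less_expo_lg[of "code z"] expo_mono[of "Suc (length z)" "Suc n"] by simp

lemma code_replicate: "code (replicate n False) = expo n"
proof (induction n)
  case 0
  show ?case by (simp add: expo_def)
next
  case (Suc n)
  then show ?case by (simp add: expo_Suc)
qed

lemma code_append: "code (xs @ ys) = code xs + 2 ^ length xs * code ys"
  by (induction xs) (simp_all add: algebra_simps)

text \<open>This turns truncation into an arithmetic term, visibly recursive. The bits dropped
  contribute a multiple of \<open>2 ^ n\<close>, and the codes of strings of length \<open>n\<close>
  are the \<open>2 ^ n\<close> numbers from \<open>expo n\<close> on, so a residue determines the
  prefix.\<close>

lemma code_take:
  assumes "n \<le> length z"
  shows "code (take n z) = expo n + (code z - expo n) mod Suc (expo n)"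
proof -
  let ?x = "take n z" and ?y = "drop n z"
  have len: "length ?x = n" using assms by simp
  have "code z = code ?x + 2 ^ n * code ?y"
    using code_append[of ?x ?y] len by simp
  moreover have "expo n \<le> code ?x" and "code ?x - expo n < 2 ^ n"
    using code_bounds[of ?x] unfolding len by (auto simp: Suc_expo[symmetric])
  ultimately have "code z - expo n = (code ?x - expo n) + 2 ^ n * code ?y" by linarith
  then have "(code z - expo n) mod 2 ^ n = code ?x - expo n"
    using \<open>code ?x - expo n < 2 ^ n\<close> by simp
  then show ?thesis using \<open>expo n \<le> code ?x\<close> by (simp add: Suc_expo)
qed

lemma rec_fun_expo:
  assumes "rec_fun k F"
  shows "rec_fun k (\<lambda>xs. expo (F xs))"
proof (rule rec_fun_comp1[OF _ assms])
  have "rec_fun (Suc 0) (\<lambda>xs. expo (xs ! 0))"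
  proof (rule rec_fun_prim[where F = "\<lambda>_. 0" and G = "\<lambda>xs. Suc (xs ! 1 + xs ! 1)"])
    show "rec_fun (Suc (Suc 0)) (\<lambda>xs. Suc (xs ! 1 + xs ! 1))"
      by (intro rec_fun_Suc rec_fun_add rec_fun_nth) auto
  qed (auto simp: rec_fun_const expo_Suc, simp add: expo_def)
  then show "rec_fun 1 (\<lambda>xs. expo (xs ! 0))" by simp
qed

text \<open>The logarithm as a search for a zero, the form that \<open>rec_fun_Least\<close>
  accepts.\<close>

lemma lg_altdef: "lg n = (LEAST k. Suc n - expo (Suc k) = 0)"
proof (rule Least_equality[symmetric])
  show "Suc n - expo (Suc (lg n)) = 0"
    using less_expo_lg[of n] by simp
  show "lg n \<le> k" if "Suc n - expo (Suc k) = 0" for k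
  proof (rule ccontr)
    assume "\<not> lg n \<le> k"
    then have "expo (Suc k) \<le> expo (lg n)" by (intro expo_mono) simp
    with that expo_lg_le[of n] show False by simp
  qed
qed

lemma rec_fun_lg:
  assumes "rec_fun k F"
  shows "rec_fun k (\<lambda>xs. lg (F xs))"
proof (rule rec_fun_comp1[OF _ assms])
  have "rec_fun 1 (\<lambda>xs. LEAST k. Suc ((k # xs) ! 1) - expo (Suc ((k # xs) ! 0)) = 0)"
  proof (rule rec_fun_Least)
    show "rec_fun (Suc 1) (\<lambda>xs. Suc (xs ! 1) - expo (Suc (xs ! 0)))"
      by (intro rec_fun_diff rec_fun_expo rec_fun_Suc rec_fun_nth) auto
    show "\<exists>n. Suc ((n # xs) ! 1) - expo (Suc ((n # xs) ! 0)) = 0" for xs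
      using less_expo_lg[of "xs ! 0"] by (intro exI[of _ "lg (xs ! 0)"]) simp
  qed
  then show "rec_fun 1 (\<lambda>xs. lg (xs ! 0))" by (simp add: lg_altdef)
qed

lemma rec_fun_pair:
  assumes "rec_fun k F" and "rec_fun k G"
  shows "rec_fun k (\<lambda>xs. pair (F xs) (G xs))"
  unfolding pair_def by (intro rec_fun_add rec_fun_expo assms)

lemma rec_fun_pair_fst:
  assumes "rec_fun k F"
  shows "rec_fun k (\<lambda>xs. pair_fst (F xs))"
  unfolding pair_fst_def by (intro rec_fun_diff rec_fun_expo rec_fun_lg assms)


section \<open>Upper bounds on complexity from machines that call \<open>U\<close>\<close>

section \<open>Complexity\<close>

text \<open>\<open>U\<close> simulates the machine that halts only on the empty string and outputs
  \<tau> there, so the coding string is itself a program for \<tau>.\<close>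

lemma universal_surj:
  assumes "universal_prefix_free_machine U"
  shows "\<exists>\<sigma>. U \<sigma> = Some \<tau>"
proof -
  obtain h where h: "\<And>xs. length xs = 1 \<Longrightarrow> evals h xs (code \<tau>)"
    using rec_fun_const[of 1 "code \<tau>"] unfolding rec_fun_def by blast
  \<comment> \<open>The search is for a zero of a function with constant value \<open>x\<close>, so
    it halts exactly for \<open>x = 0\<close>. By call-by-value, composing \<open>h\<close> with it
    restricts \<open>h\<close> to that input.\<close>
  have mu: "evals (Mu (Proj (Suc 0))) [x] n \<longleftrightarrow> x = 0 \<and> n = 0" for x n
  proof
    assume "evals (Mu (Proj (Suc 0))) [x] n"
    then obtain f where ev: "evals (Proj (Suc 0)) [n, x] 0"
      and less: "\<And>m. m < n \<Longrightarrow> \<exists>v. evals (Proj (Suc 0)) [m, x] (Suc v)"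
      by (auto elim: evals_MuE)
    from ev have "x = 0" by (rule evals_ProjE) simp
    moreover have "\<not> 0 < n"
      using less[of 0] \<open>x = 0\<close> by (fastforce elim: evals_ProjE)
    ultimately show "x = 0 \<and> n = 0" by simp
  next
    assume "x = 0 \<and> n = 0"
    then show "evals (Mu (Proj (Suc 0))) [x] n"
      using evals.proj[of 1 "[0, 0]"] by (auto intro!: evals.mu)
  qed
  have ev: "evals (Comp h [Mu (Proj (Suc 0))]) [x] y \<longleftrightarrow> x = 0 \<and> y = code \<tau>" for x y
  proof
    assume "evals (Comp h [Mu (Proj (Suc 0))]) [x] y"
    then obtain n where "evals (Mu (Proj (Suc 0))) [x] n" and "evals h [n] y"
      by (elim evals_CompE) (auto simp: list_all2_Cons1)
    then show "x = 0 \<and> y = code \<tau>"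
      using h[of "[n]"] by (auto simp: mu dest: evals_deterministic)
  next
    assume "x = 0 \<and> y = code \<tau>"
    then show "evals (Comp h [Mu (Proj (Suc 0))]) [x] y"
      using h[of "[0]"] by (intro evals.comp[where vs = "[0]"]) (auto simp: mu)
  qed
  define M :: "bool list \<rightharpoonup> bool list" where "M = [[] \<mapsto> \<tau>]"
  have "code \<sigma> = 0 \<longleftrightarrow> \<sigma> = []" for \<sigma> by (cases \<sigma>) auto
  then have "partial_recursive M"
    unfolding partial_recursive_def
    by (intro exI[of _ "Comp h [Mu (Proj (Suc 0))]"]) (auto simp: ev M_def)
  then have "prefix_free_machine M"
    unfolding prefix_free_machine_def by (auto simp: M_def)
  then obtain \<rho> where "\<forall>\<sigma>. U (\<rho> @ \<sigma>) = M \<sigma>"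
    using assms unfolding universal_prefix_free_machine_def by blast
  then have "U (\<rho> @ []) = Some \<tau>" unfolding M_def by (metis fun_upd_same)
  then show ?thesis by blast
qed

lemma K_le: "U \<sigma> = Some \<tau> \<Longrightarrow> K U \<tau> \<le> length \<sigma>"
  unfolding K_def by (rule Least_le) blast

lemma K_attained:
  assumes "universal_prefix_free_machine U"
  shows "\<exists>\<sigma>. length \<sigma> = K U \<tau> \<and> U \<sigma> = Some \<tau>"
  unfolding K_def by (rule LeastI_ex) (use universal_surj[OF assms] in blast)

text \<open>Machines that halt only on inputs in the domain of \<open>U\<close> are prefix-free for free.\<close>

lemma K_le_two_calls:
  assumes U: "universal_prefix_free_machine U"
    and G: "rec_fun 1 (\<lambda>xs. G (xs ! 0))"
    and H: "rec_fun 3 (\<lambda>xs. H (xs ! 0) (xs ! 1) (xs ! 2))"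
  shows "\<exists>d. \<forall>q z p w \<tau>. U q = Some z \<longrightarrow> code p = G (code z) \<longrightarrow> U p = Some w \<longrightarrow>
    code \<tau> = H (code q) (code z) (code w) \<longrightarrow> K U \<tau> \<le> length q + d"
proof -
  have pfU: "prefix_free_machine U"
    using U unfolding universal_prefix_free_machine_def by blast
  then obtain f where f: "\<And>\<sigma> y. evals f [code \<sigma>] y \<longleftrightarrow> map_option code (U \<sigma>) = Some y"
    unfolding prefix_free_machine_def partial_recursive_def by blast
  obtain g where g: "\<And>x. evals g [x] (G x)"
  proof -
    obtain g where g: "\<And>xs. length xs = 1 \<Longrightarrow> evals g xs (G (xs ! 0))"
      using G unfolding rec_fun_def by blast
    show thesis using g[of "[_]"] by (intro that[of g]) simp
  qed
  obtain h where h: "\<And>x y z. evals h [x, y, z] (H x y z)"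
  proof -
    obtain h where h: "\<And>xs. length xs = 3 \<Longrightarrow> evals h xs (H (xs ! 0) (xs ! 1) (xs ! 2))"
      using H unfolding rec_fun_def by blast
    show thesis using h[of "[_, _, _]"] by (intro that[of h]) simp
  qed
  define dec where "dec = inv code"
  have code_dec [simp]: "code (dec n) = n" for n
    unfolding dec_def by (rule surj_f_inv_f) (rule bij_is_surj[OF bij_code])
  have dec_code [simp]: "dec (code \<sigma>) = \<sigma>" for \<sigma>
    unfolding dec_def by (rule inv_f_f) (rule bij_is_inj[OF bij_code])
  \<comment> \<open>The first run of \<open>U\<close> is on the input itself, the second on the
    string that \<open>G\<close> computes from the first output; \<open>h\<close> combines the input
    with both outputs. By call-by-value, \<open>m\<close> diverges as soon as one run does.\<close>
  define m where "m = Comp h [Proj 0, f, Comp f [Comp g [f]]]"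
  have m: "evals m [code \<sigma>] y \<longleftrightarrow> (\<exists>z w. U \<sigma> = Some z \<and> U (dec (G (code z))) = Some w \<and>
    y = H (code \<sigma>) (code z) (code w))" for \<sigma> y
  proof
    assume "evals m [code \<sigma>] y"
    then obtain s u v where s: "evals (Proj 0) [code \<sigma>] s" and u: "evals f [code \<sigma>] u"
      and v: "evals (Comp f [Comp g [f]]) [code \<sigma>] v" and y: "evals h [s, u, v] y"
      unfolding m_def by (elim evals_CompE) (auto simp: list_all2_Cons1)
    from s have s': "s = code \<sigma>" by (rule evals_ProjE) simp
    from u obtain z where z: "U \<sigma> = Some z" "u = code z" by (auto simp: f)
    from v obtain x where x: "evals (Comp g [f]) [code \<sigma>] x" and v': "evals f [x] v"
      by (elim evals_CompE) (auto simp: list_all2_Cons1)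
    from x obtain u' where u': "evals f [code \<sigma>] u'" "evals g [u'] x"
      by (elim evals_CompE) (auto simp: list_all2_Cons1)
    have "u' = code z" using u'(1) z by (simp add: f)
    then have "x = G (code z)" using evals_deterministic[OF u'(2) g] by simp
    then have "evals f [code (dec (G (code z)))] v" using v' by simp
    then obtain w where w: "U (dec (G (code z))) = Some w" "v = code w"
      unfolding f by auto
    have "y = H (code \<sigma>) (code z) (code w)"
      using evals_deterministic[OF y h] by (simp add: s' z w)
    with z w show "\<exists>z w. U \<sigma> = Some z \<and> U (dec (G (code z))) = Some w \<and>
      y = H (code \<sigma>) (code z) (code w)" by blast
  next
    assume "\<exists>z w. U \<sigma> = Some z \<and> U (dec (G (code z))) = Some w \<and>
      y = H (code \<sigma>) (code z) (code w)"
    then obtain z w where z: "U \<sigma> = Some z" and w: "U (dec (G (code z))) = Some w"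
      and y: "y = H (code \<sigma>) (code z) (code w)" by blast
    have fz: "evals f [code \<sigma>] (code z)" using z by (simp add: f)
    then have "evals (Comp g [f]) [code \<sigma>] (G (code z))"
      by (intro evals.comp[where vs = "[code z]"]) (auto simp: g)
    moreover have "evals f [G (code z)] (code w)"
      using f[of "dec (G (code z))" "code w"] w by simp
    ultimately have "evals (Comp f [Comp g [f]]) [code \<sigma>] (code w)"
      by (intro evals.comp[where vs = "[G (code z)]"]) auto
    moreover have "evals (Proj 0) [code \<sigma>] (code \<sigma>)"
      using evals.proj[of 0 "[code \<sigma>]"] by simp
    ultimately show "evals m [code \<sigma>] y"
      unfolding m_def y using fz h
      by (intro evals.comp[where vs = "[code \<sigma>, code z, code w]"]) auto
  qed
  define M where "M = (\<lambda>\<sigma>. Option.bind (U \<sigma>) (\<lambda>z. map_option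
    (\<lambda>w. dec (H (code \<sigma>) (code z) (code w))) (U (dec (G (code z))))))"
  have "partial_recursive M"
    unfolding partial_recursive_def
    by (intro exI[of _ m] allI) (auto simp: m M_def bind_eq_Some_conv)
  moreover have "dom M \<subseteq> dom U" by (auto simp: M_def bind_eq_Some_conv)
  ultimately have "prefix_free_machine M"
    using pfU unfolding prefix_free_machine_def by blast
  then obtain \<rho> where \<rho>: "\<And>\<sigma>. U (\<rho> @ \<sigma>) = M \<sigma>"
    using U unfolding universal_prefix_free_machine_def by blast
  have "K U \<tau> \<le> length q + length \<rho>"
    if "U q = Some z" "code p = G (code z)" "U p = Some w"
      "code \<tau> = H (code q) (code z) (code w)" for q z p w \<tau>
  proof -
    have "dec (G (code z)) = p" using dec_code[of p] that(2) by simp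
    moreover have "dec (H (code q) (code z) (code w)) = \<tau>"
      using dec_code[of \<tau>] that(4) by simp
    ultimately have "U (\<rho> @ q) = Some \<tau>"
      using that(1,3) by (simp add: \<rho> M_def)
    from K_le[of U, OF this] show ?thesis by simp
  qed
  then show ?thesis by blast
qed

text \<open>A machine that reads \<open>H\<close> off the program \<open>q\<close> itself, waiting
  only for \<open>U\<close> to halt on it, inherits the domain of \<open>U\<close>. The second call
  of \<open>K_le_two_calls\<close> is filled by a fixed halting program.\<close>

lemma K_nat_le:
  assumes U: "universal_prefix_free_machine U" and H: "rec_fun 1 (\<lambda>xs. H (xs ! 0))"
  shows "\<exists>d. \<forall>q\<in>dom U. K_nat U (H (code q)) \<le> length q + d"
proof -
  obtain p w where p: "U p = Some w" using universal_surj[OF U] by blast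
  have "rec_fun 3 (\<lambda>xs. expo (H (xs ! 0)))"
    by (intro rec_fun_expo rec_fun_comp1[OF H] rec_fun_nth) simp
  from K_le_two_calls[OF U rec_fun_const[of 1 "code p"], OF this] p
  obtain d where "\<And>q z \<tau>. U q = Some z \<Longrightarrow> code \<tau> = expo (H (code q)) \<Longrightarrow>
    K U \<tau> \<le> length q + d" by blast
  then have "\<forall>q\<in>dom U. K_nat U (H (code q)) \<le> length q + d"
    by (auto simp: K_nat_def code_replicate)
  then show ?thesis by blast
qed

text \<open>The program \<open>q\<close> alone suffices: the length of its output reveals
  \<open>p\<close>, a second run recovers \<open>w\<close>, and the codes of \<open>p\<close> and
  \<open>q\<close> say where to cut. In the application \<open>w\<close> is a long initial segment
  of \<open>A\<close>.\<close>

lemma K_take_le: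
  assumes U: "universal_prefix_free_machine U"
  shows "\<exists>d. \<forall>p q z w b. U p = Some w \<longrightarrow> U q = Some z \<longrightarrow> length z = pair (code p) b \<longrightarrow>
    pair (code p) (code q) \<le> length w \<longrightarrow>
    K U (take (pair (code p) (code q)) w) \<le> length q + d"
proof -
  \<comment> \<open>The cutting point, from the code \<open>s\<close> of \<open>q\<close> and the
    code \<open>y\<close> of its output, whose length is \<open>lg y\<close>.\<close>
  define n where "n s y = pair (pair_fst (lg y)) s" for s y
  have "rec_fun 1 (\<lambda>xs. pair_fst (lg (xs ! 0)))"
    by (intro rec_fun_pair_fst rec_fun_lg rec_fun_nth) simp
  moreover have "rec_fun 3 (\<lambda>xs. expo (n (xs ! 0) (xs ! 1)) +
      (xs ! 2 - expo (n (xs ! 0) (xs ! 1))) mod Suc (expo (n (xs ! 0) (xs ! 1))))"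
    unfolding n_def
    by (intro rec_fun_pair_fst rec_fun_lg rec_fun_add rec_fun_mod rec_fun_diff rec_fun_Suc
        rec_fun_expo rec_fun_pair rec_fun_nth) simp_all
  ultimately have "\<exists>d. \<forall>q z p w \<tau>. U q = Some z \<longrightarrow> code p = pair_fst (lg (code z)) \<longrightarrow>
      U p = Some w \<longrightarrow> code \<tau> = expo (n (code q) (code z)) +
      (code w - expo (n (code q) (code z))) mod Suc (expo (n (code q) (code z))) \<longrightarrow>
      K U \<tau> \<le> length q + d"
    by (rule K_le_two_calls[OF U, where G = "\<lambda>y. pair_fst (lg y)" and
        H = "\<lambda>s y v. expo (n s y) + (v - expo (n s y)) mod Suc (expo (n s y))"])
  then obtain d where d: "\<forall>q z p w \<tau>. U q = Some z \<longrightarrow> code p = pair_fst (lg (code z)) \<longrightarrow>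
      U p = Some w \<longrightarrow> code \<tau> = expo (n (code q) (code z)) +
      (code w - expo (n (code q) (code z))) mod Suc (expo (n (code q) (code z))) \<longrightarrow>
      K U \<tau> \<le> length q + d" ..
  have "K U (take (pair (code p) (code q)) w) \<le> length q + d"
    if "U p = Some w" "U q = Some z" "length z = pair (code p) b"
      "pair (code p) (code q) \<le> length w" for p q z w b
    using that by (intro d[rule_format, of q z p w]) (simp_all add: code_take n_def)
  then show ?thesis by blast
qed


section \<open>Kraft's inequality and separation of finitely many reals\<close>

section \<open>Counting\<close>

definition kraft :: "bool list set \<Rightarrow> real" where
  "kraft W = (\<Sum>\<sigma>\<in>W. (1 / 2) ^ length \<sigma>)"

text \<open>Induction on a strict bound for the lengths. If the empty string is present, it is
  alone; otherwise the set splits by first bit, and removing that bit doubles the weight of each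
  half.\<close>

lemma kraft_le_1:
  assumes "finite W" and "\<And>\<sigma> \<tau>. \<sigma> \<in> W \<Longrightarrow> \<tau> \<in> W \<Longrightarrow> \<not> strict_prefix \<sigma> \<tau>"
  shows "kraft W \<le> 1"
proof -
  have "kraft W \<le> 1"
    if "finite W" "\<And>\<sigma> \<tau>. \<sigma> \<in> W \<Longrightarrow> \<tau> \<in> W \<Longrightarrow> \<not> strict_prefix \<sigma> \<tau>"
      "\<And>\<sigma>. \<sigma> \<in> W \<Longrightarrow> length \<sigma> < m" for m W
    using that
  proof (induction m arbitrary: W)
    case 0
    then have "W = {}" by auto
    then show ?case by (simp add: kraft_def)
  next
    case (Suc m)
    show ?case
    proof (cases "[] \<in> W")
      case True
      have "W = {[]}"
        using True Suc.prems(2)[OF True] by (auto simp: strict_prefix_def)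
      then show ?thesis by (simp add: kraft_def)
    next
      case False
      define V where "V b = {\<sigma>. b # \<sigma> \<in> W}" for b
      have fin: "finite (V b)" for b
        using finite_vimageI[OF \<open>finite W\<close>, of "Cons b"] by (simp add: V_def vimage_def)
      have le: "kraft (V b) \<le> 1" for b
      proof (rule Suc.IH[OF fin])
        show "\<not> strict_prefix \<sigma> \<tau>" if "\<sigma> \<in> V b" "\<tau> \<in> V b" for \<sigma> \<tau>
          using Suc.prems(2)[of "b # \<sigma>" "b # \<tau>"] that by (auto simp: V_def)
        show "length \<sigma> < m" if "\<sigma> \<in> V b" for \<sigma>
          using Suc.prems(3)[of "b # \<sigma>"] that by (simp add: V_def)
      qed
      have half: "kraft (Cons b ` V b) = kraft (V b) / 2" for b
        unfolding kraft_def by (simp add: sum.reindex sum_divide_distrib)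
      have W: "W = Cons True ` V True \<union> Cons False ` V False"
      proof (intro set_eqI iffI)
        fix \<sigma> assume "\<sigma> \<in> W"
        moreover from this False obtain b \<tau> where "\<sigma> = b # \<tau>" by (cases \<sigma>) auto
        ultimately show "\<sigma> \<in> Cons True ` V True \<union> Cons False ` V False"
          by (cases b) (auto simp: V_def)
      qed (auto simp: V_def)
      have "kraft W = kraft (Cons True ` V True) + kraft (Cons False ` V False)"
        unfolding kraft_def by (subst W, rule sum.union_disjoint) (auto simp: fin)
      also have "\<dots> \<le> 1" using le[of True] le[of False] by (simp add: half)
      finally show ?thesis .
    qed
  qed
  from this[of W "Suc (Max (length ` W))"] assms show ?thesis
    by (simp add: le_imp_less_Suc)
qed

lemma inj_on_restrict:
  assumes "finite F"
  shows "\<exists>n0. \<forall>n\<ge>n0. inj_on (\<lambda>B. B \<restriction> n) F"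
proof -
  \<comment> \<open>For \<open>B = C\<close> the choice is an arbitrary number, which can only raise
    the maximum; inserting 0 covers empty \<open>F\<close>.\<close>
  define i where "i B C = (SOME k. B k \<noteq> C k)" for B C :: cantor
  define n0 where "n0 = Suc (Max (insert 0 ((\<lambda>(B, C). i B C) ` (F \<times> F))))"
  have "B = C" if "B \<in> F" "C \<in> F" "n0 \<le> n" and eq: "B \<restriction> n = C \<restriction> n" for B C n
  proof (rule ccontr)
    assume "B \<noteq> C"
    then obtain k where "B k \<noteq> C k" by blast
    then have "B (i B C) \<noteq> C (i B C)" unfolding i_def by (rule someI)
    moreover have "i B C \<le> Max (insert 0 ((\<lambda>(B, C). i B C) ` (F \<times> F)))"
      using that(1,2) assms by (intro Max_ge) auto
    then have "i B C < n" using that(3) by (simp add: n0_def)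
    then have "B (i B C) = (B \<restriction> n) ! i B C" "C (i B C) = (C \<restriction> n) ! i B C"
      by (simp_all add: restrict_def)
    with eq have "B (i B C) = C (i B C)" by metis
    ultimately show False by simp
  qed
  then have "\<forall>n\<ge>n0. inj_on (\<lambda>B. B \<restriction> n) F" by (intro allI impI inj_onI)
  then show ?thesis ..
qed

lemma length_restrict [simp]: "length (A \<restriction> n) = n"
  by (simp add: restrict_def)

lemma take_restrict: "m \<le> n \<Longrightarrow> take m (A \<restriction> n) = A \<restriction> m"
  by (simp add: restrict_def take_map)

text \<open>Bounded codes would leave \<open>U\<close> a finite domain, although every string is an
  output.\<close>

lemma dom_code_unbounded:
  assumes U: "universal_prefix_free_machine U"
  shows "\<exists>q\<in>dom U. m \<le> code q"
proof (rule ccontr)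
  assume "\<not> ?thesis"
  then have "dom U \<subseteq> code -` {..<m}" by (auto simp: not_le)
  moreover have "finite (code -` {..<m})"
    using bij_is_inj[OF bij_code] by (rule finite_vimageI[OF finite_lessThan])
  ultimately have "finite (ran U)" by (intro finite_ran) (rule finite_subset)
  moreover have "ran U = UNIV" using universal_surj[OF U] by (auto simp: ran_def)
  ultimately show False using infinite_UNIV_listI[where ?'a = bool] by simp
qed


section \<open>The doubling argument and finiteness for each constant\<close>

section \<open>Lower cones\<close>

text \<open>The programs that \<^const>\<open>pair_fst\<close> leads back to \<open>p\<close>: the length of their output codes a
  pair with first component \<open>p\<close>.\<close>

definition pointing :: "(bool list \<rightharpoonup> bool list) \<Rightarrow> bool list \<Rightarrow> nat \<Rightarrow> bool list set \<Rightarrow> bool" where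
  "pointing U p L W \<longleftrightarrow> finite W \<and>
    (\<forall>q\<in>W. length q \<le> L \<and> (\<exists>z b. U q = Some z \<and> length z = pair (code p) b))"

lemma kraft_pointing_le_1:
  assumes "universal_prefix_free_machine U" and "pointing U p L W"
  shows "kraft W \<le> 1"
proof (rule kraft_le_1)
  have "\<forall>\<sigma>\<in>dom U. \<forall>\<tau>\<in>dom U. \<not> strict_prefix \<sigma> \<tau>"
    using assms(1) by (simp add: universal_prefix_free_machine_def prefix_free_machine_def)
  moreover have "W \<subseteq> dom U" using assms(2) by (auto simp: pointing_def)
  ultimately show "\<not> strict_prefix \<sigma> \<tau>" if "\<sigma> \<in> W" "\<tau> \<in> W" for \<sigma> \<tau>
    using that by (meson subsetD)
qed (use assms(2) in \<open>simp add: pointing_def\<close>)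

text \<open>Each \<open>q\<close> is replaced by one shortest program per real in \<open>F\<close>.
  These are longer by at most \<open>c + d\<close>, and there are \<open>2 ^ (c + d + 1)\<close> of
  them, so the weight gains a factor 2.\<close>

lemma kraft_doubling:
  assumes U: "universal_prefix_free_machine U"
    and d: "\<And>q z b. U q = Some z \<Longrightarrow> length z = pair (code p) b \<Longrightarrow>
      pair (code p) (code q) \<le> n \<Longrightarrow> K U (A \<restriction> pair (code p) (code q)) \<le> length q + d"
    and F: "finite F" "card F = 2 ^ (c + d + 1)"
    and c: "\<And>B m. B \<in> F \<Longrightarrow> K U (B \<restriction> m) \<le> K U (A \<restriction> m) + c"
    and inj: "\<And>m. code p \<le> m \<Longrightarrow> inj_on (\<lambda>B. B \<restriction> m) F"
    and W: "pointing U p L W"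
    and n: "\<And>q. length q \<le> L \<Longrightarrow> pair (code p) (code q) \<le> n"
  shows "\<exists>W'. pointing U p (L + (c + d)) W' \<and> 2 * kraft W \<le> kraft W'"
proof -
  define m where "m q = pair (code p) (code q)" for q
  have "\<forall>\<tau>. \<exists>\<sigma>. length \<sigma> = K U \<tau> \<and> U \<sigma> = Some \<tau>" by (intro allI K_attained[OF U])
  then obtain s where s: "\<And>\<tau>. length (s \<tau>) = K U \<tau>" "\<And>\<tau>. U (s \<tau>) = Some \<tau>" by metis
  define r where "r q B = s (B \<restriction> m q)" for q B
  have r: "length (r q B) = K U (B \<restriction> m q)" "U (r q B) = Some (B \<restriction> m q)" for q B
    by (simp_all add: r_def s)
  define W' where "W' = (\<lambda>(q, B). r q B) ` (W \<times> F)"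
  have finW: "finite W" using W by (simp add: pointing_def)
  have inj_r: "inj_on (\<lambda>(q, B). r q B) (W \<times> F)"
  proof (rule inj_onI, clarify)
    fix q B q' B'
    assume "B \<in> F" "B' \<in> F" and "r q B = r q' B'"
    then have eq: "B \<restriction> m q = B' \<restriction> m q'"
      using r(2)[of q B] r(2)[of q' B'] by simp
    \<comment> \<open>Equal outputs have equal lengths, which determine \<open>q\<close>; at a
      common length beyond \<open>code p\<close>, the reals in \<open>F\<close> are already
      distinguished.\<close>
    then have "length (B \<restriction> m q) = length (B' \<restriction> m q')" by (rule arg_cong)
    then have "m q = m q'" by simp
    then have "code q = code q'"
      unfolding m_def by (rule injD[OF inj_pair])
    then have "q = q'" by (rule injD[OF bij_is_inj[OF bij_code]])
    moreover have "B = B'"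
    proof (rule inj_onD[OF inj])
      show "code p \<le> m q" by (simp add: m_def pair_ge_fst)
      show "B \<restriction> m q = B' \<restriction> m q" using eq unfolding \<open>m q = m q'\<close> .
    qed fact+
    ultimately show "q = q' \<and> B = B'" ..
  qed
  have len: "length (r q B) \<le> length q + (c + d)" if "q \<in> W" "B \<in> F" for q B
  proof -
    obtain z b where "U q = Some z" "length z = pair (code p) b" "length q \<le> L"
      using W \<open>q \<in> W\<close> unfolding pointing_def by blast
    then have "K U (A \<restriction> m q) \<le> length q + d"
      unfolding m_def by (rule d[OF _ _ n])
    with c[OF \<open>B \<in> F\<close>, of "m q"] show ?thesis by (simp add: r(1))
  qed
  have "pointing U p (L + (c + d)) W'"
    unfolding pointing_def
  proof (intro conjI ballI)
    show "finite W'" using finW F(1) by (simp add: W'_def)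
    fix s assume "s \<in> W'"
    then obtain q B where s: "q \<in> W" "B \<in> F" "s = r q B" by (auto simp: W'_def)
    moreover have "length q \<le> L" using W s(1) by (simp add: pointing_def)
    ultimately show "length s \<le> L + (c + d)" using len[of q B] by simp
    \<comment> \<open>The new programs point to \<open>p\<close> again: the second component of the
      pair is now the code of the old program.\<close>
    have "U s = Some (B \<restriction> m q)" "length (B \<restriction> m q) = pair (code p) (code q)"
      using r(2) s(3) by (simp_all add: m_def)
    then show "\<exists>z b. U s = Some z \<and> length z = pair (code p) b" by blast
  qed
  moreover have "2 * kraft W \<le> kraft W'"
  proof -
    have weight: "real (card F) * (1 / 2) ^ (l + (c + d)) = 2 * (1 / 2) ^ l" for l
    proof -
      have "real (card F) * (1 / 2) ^ (l + (c + d)) =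
          2 * (1 / 2) ^ l * (2 ^ (c + d) * (1 / 2) ^ (c + d))"
        unfolding F(2) power_add[of _ l] by simp
      also have "2 ^ (c + d) * (1 / 2) ^ (c + d) = (1::real)"
        by (simp flip: power_mult_distrib)
      finally show ?thesis by simp
    qed
    have "2 * kraft W = (\<Sum>q\<in>W. \<Sum>B\<in>F. (1 / 2) ^ (length q + (c + d)))"
      by (simp only: kraft_def sum_distrib_left sum_constant weight)
    also have "\<dots> \<le> (\<Sum>q\<in>W. \<Sum>B\<in>F. (1 / 2) ^ length (r q B))"
      by (intro sum_mono power_decreasing len) auto
    also have "\<dots> = kraft W'"
      unfolding kraft_def W'_def sum.reindex[OF inj_r]
      by (simp add: sum.cartesian_product case_prod_unfold)
    finally show ?thesis .
  qed
  ultimately show ?thesis by blast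
qed

lemma finite_lower_cone:
  assumes U: "universal_prefix_free_machine U" and A: "A \<in> KT U (\<lambda>n. lg (lg (lg n)))"
  shows "finite {B. \<forall>n. K U (B \<restriction> n) \<le> K U (A \<restriction> n) + c}" (is "finite ?S")
proof (rule ccontr)
  assume inf: "infinite ?S"
  obtain a where a: "\<And>n. K U (A \<restriction> n) \<le> K_nat U n + lg (lg (lg n)) + a"
    using A unfolding KT_def by blast
  obtain d where d: "\<And>p q z w b. U p = Some w \<Longrightarrow> U q = Some z \<Longrightarrow> length z = pair (code p) b \<Longrightarrow>
      pair (code p) (code q) \<le> length w \<Longrightarrow>
      K U (take (pair (code p) (code q)) w) \<le> length q + d"
    using K_take_le[OF U] by blast
  have "rec_fun 1 (\<lambda>xs. expo (expo (xs ! 0)))"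
    by (intro rec_fun_expo rec_fun_nth) simp
  then obtain d' where d': "\<And>q. q \<in> dom U \<Longrightarrow> K_nat U (expo (expo (code q))) \<le> length q + d'"
    using K_nat_le[OF U, of "\<lambda>x. expo (expo x)"] by blast
  have "rec_fun 1 (\<lambda>xs. pair (xs ! 0) 0)"
    by (intro rec_fun_pair rec_fun_const rec_fun_nth) simp
  then obtain d'' where d'': "\<And>q. q \<in> dom U \<Longrightarrow> K_nat U (pair (code q) 0) \<le> length q + d''"
    using K_nat_le[OF U, of "\<lambda>x. pair x 0"] by blast
  obtain F where F: "finite F" "card F = 2 ^ (c + d + 1)" "F \<subseteq> ?S"
    using infinite_arbitrarily_large[OF inf] by blast
  obtain n0 where n0: "\<And>n. n0 \<le> n \<Longrightarrow> inj_on (\<lambda>B. B \<restriction> n) F"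
    using inj_on_restrict[OF F(1)] by blast
  \<comment> \<open>Chosen so that \<open>L + 3 \<le> e * (lg x + 1)\<close> for the length bound
    \<open>L\<close> below, which is linear in \<open>length p\<close> and hence in
    \<open>lg x\<close>.\<close>
  define e where "e = (3 + d' + a + d'') * (c + d + 1) + 3"
  obtain m1 where m1: "\<And>x. m1 \<le> x \<Longrightarrow> e * (lg x + 1) \<le> x"
    using mult_lg_le by blast
  \<comment> \<open>A bound for the outputs of programs with code below \<open>n0\<close>: an output
    longer than \<open>m2\<close> forces \<open>n0 \<le> code p\<close>. Diverging programs add an
    arbitrary length, which is harmless.\<close>
  define m2 where "m2 = Max (insert 0 ((\<lambda>p. length (the (U p))) ` (code -` {..<n0})))"
  have m2: "length w \<le> m2" if "U p = Some w" "code p < n0" for p w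
  proof -
    have "finite (code -` {..<n0})"
      using bij_is_inj[OF bij_code] by (rule finite_vimageI[OF finite_lessThan])
    then show ?thesis
      unfolding m2_def using that by (intro Max_ge) (auto simp: image_iff intro!: bexI[of _ p])
  qed
  \<comment> \<open>Taking \<open>x\<close> to be the code of a halting program makes
    \<open>n\<close> simple: \<open>q0\<close> has length \<open>lg x\<close>, which bounds the
    complexity of \<open>n\<close> up to \<open>d'\<close>. The triple logarithm of \<open>n\<close>
    is also \<open>lg x\<close>, whence the \<open>2 * lg x\<close> in \<open>len_p\<close>.\<close>
  obtain q0 where q0: "q0 \<in> dom U" "max m1 (Suc m2) \<le> code q0"
    using dom_code_unbounded[OF U] by blast
  define x where "x = code q0"
  define n where "n = expo (expo x)"
  obtain p where p: "length p = K U (A \<restriction> n)" "U p = Some (A \<restriction> n)"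
    using K_attained[OF U] by blast
  have "length p \<le> K_nat U n + lg (lg (lg n)) + a" using a[of n] p(1) by simp
  also have "\<dots> \<le> length q0 + d' + lg x + a"
    using d'[OF q0(1)] by (simp add: n_def x_def)
  finally have len_p: "length p \<le> 2 * lg x + d' + a" by (simp add: x_def)
  have "x \<le> n" unfolding n_def using expo_ge le_trans by blast
  have code_p: "n0 \<le> code p"
  proof (rule ccontr)
    assume "\<not> n0 \<le> code p"
    then have "n \<le> m2" using m2[OF p(2)] by simp
    with \<open>x \<le> n\<close> q0(2) show False by (simp add: x_def)
  qed
  \<comment> \<open>\<open>L0\<close> bounds the length of the first pointing program, whose weight
    is thus at least \<open>2 ^ -L0\<close>. So \<open>L0 + 1\<close> doublings reach weight 2, and
    each adds at most \<open>c + d\<close> to the lengths.\<close>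
  define L0 where "L0 = length p + d''"
  define L where "L = L0 + (L0 + 1) * (c + d)"
  \<comment> \<open>The 3 consists of one increment from \<open>code_le\<close> and two from
    \<open>pair_le\<close>.\<close>
  have "L + 3 \<le> e * (lg x + 1)"
  proof -
    have "L0 + 1 \<le> (3 + d' + a + d'') * (lg x + 1)"
      using len_p by (simp add: L0_def algebra_simps)
    then have "(L0 + 1) * (c + d + 1) \<le> (3 + d' + a + d'') * (lg x + 1) * (c + d + 1)"
      by (rule mult_le_mono1)
    moreover have "L + 1 = (L0 + 1) * (c + d + 1)" by (simp add: L_def)
    ultimately have "L + 3 \<le> (3 + d' + a + d'') * (lg x + 1) * (c + d + 1) + 3" by linarith
    also have "\<dots> \<le> e * (lg x + 1)" by (simp add: e_def algebra_simps)
    finally show ?thesis .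
  qed
  then have "L + 3 \<le> x" using m1[of x] q0(2) by (simp add: x_def)
  have pair_le_n: "pair (code p) (code q) \<le> n" if "length q \<le> L" for q
  proof -
    have "pair (code p) (code q) \<le> expo (expo (Suc (Suc (Suc L))))"
      using that by (intro pair_le code_le) (simp_all add: L_def L0_def)
    also have "\<dots> \<le> n"
      unfolding n_def using \<open>L + 3 \<le> x\<close> by (intro expo_mono) simp
    finally show ?thesis .
  qed
  have dA: "K U (A \<restriction> pair (code p) (code q)) \<le> length q + d"
    if "U q = Some z" "length z = pair (code p) b" "pair (code p) (code q) \<le> n" for q z b
    using d[OF p(2) that(1,2)] that(3) by (simp add: take_restrict)
  have "\<exists>W. pointing U p (L0 + k * (c + d)) W \<and> 2 ^ k * (1 / 2) ^ L0 \<le> kraft W"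
    if "k \<le> L0 + 1" for k
    using that
  proof (induction k)
    case 0
    \<comment> \<open>The first pointing program describes a string of zeros whose length codes
      \<open>p\<close>; it costs at most \<open>d''\<close> more than \<open>p\<close>.\<close>
    obtain q where q: "length q = K_nat U (pair (code p) 0)"
        "U q = Some (replicate (pair (code p) 0) False)"
      using K_attained[OF U] unfolding K_nat_def by blast
    have "length q \<le> L0" using d''[of p] p(2) q(1) by (auto simp: L0_def)
    then have "pointing U p L0 {q}" using q(2) by (auto simp: pointing_def)
    moreover have "(1 / 2) ^ L0 \<le> kraft {q}"
      using \<open>length q \<le> L0\<close> by (simp add: kraft_def power_decreasing)
    ultimately show ?case by (intro exI[of _ "{q}"]) simp
  next
    case (Suc k)
    then obtain W where W: "pointing U p (L0 + k * (c + d)) W" "2 ^ k * (1 / 2) ^ L0 \<le> kraft W"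
      by auto
    \<comment> \<open>The limit on the number of rounds keeps every cutting point within the initial
      segment of length \<open>n\<close>.\<close>
    have "L0 + k * (c + d) \<le> L"
      unfolding L_def using Suc.prems by (intro add_left_mono mult_le_mono1) simp
    then have "\<exists>W'. pointing U p (L0 + k * (c + d) + (c + d)) W' \<and> 2 * kraft W \<le> kraft W'"
      using F(3) code_p
      by (intro kraft_doubling[OF U _ F(1,2) _ _ W(1), where A = A and n = n])
        (auto intro: dA n0 pair_le_n)
    then obtain W' where "pointing U p (L0 + k * (c + d) + (c + d)) W'" "2 * kraft W \<le> kraft W'"
      by blast
    with W(2) show ?case by (intro exI[of _ W']) (simp add: algebra_simps)
  qed
  then obtain W where W: "pointing U p (L0 + (L0 + 1) * (c + d)) W"
      "2 ^ (L0 + 1) * (1 / 2) ^ L0 \<le> kraft W"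
    by blast
  have "(2::real) ^ (L0 + 1) * (1 / 2) ^ L0 = 2"
    by (simp add: power_divide)
  with W(2) kraft_pointing_le_1[OF U W(1)] show False by linarith
qed

lemma is_order_lg3: "is_order (\<lambda>n. lg (lg (lg n)))"
proof -
  have "\<exists>n. m < lg (lg (lg n))" for m
    by (rule exI[of _ "expo (expo (expo (Suc m)))"]) simp
  then have "\<not> bdd_above (range (\<lambda>n. lg (lg (lg n))))"
    by (auto simp: bdd_above_def not_le)
  moreover have "mono (\<lambda>n. lg (lg (lg n)))"
    by (intro monoI monoD[OF mono_lg])
  ultimately show ?thesis by (simp add: is_order_def)
qed

theorem theorem4p1:
  fixes U :: "bool list \<rightharpoonup> bool list" and A :: cantor
  assumes "universal_prefix_free_machine U"
    and "A \<in> KT_Delta02 U"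
  shows "countable {B. le_K U B A}"
proof -
  have "Delta02_fun (\<lambda>n. lg (lg (lg n)))"
    by (intro Delta02_fun_if_rec_fun rec_fun_lg rec_fun_nth) simp
  with assms(2) is_order_lg3 have "A \<in> KT U (\<lambda>n. lg (lg (lg n)))"
    unfolding KT_Delta02_def by blast
  \<comment> \<open>One finite set for each additive constant.\<close>
  then have "countable (\<Union>c. {B. \<forall>n. K U (B \<restriction> n) \<le> K U (A \<restriction> n) + c})"
    using finite_lower_cone[OF assms(1)] by (intro countable_UN) (auto intro: countable_finite)
  moreover have "{B. le_K U B A} = (\<Union>c. {B. \<forall>n. K U (B \<restriction> n) \<le> K U (A \<restriction> n) + c})"
    by (auto simp: le_K_def)
  ultimately show ?thesis by simp
qed

end
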